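(* Let $d\ge 1$, $\Omega=(-\pi,\pi)^d$ with periodic boundary conditions, and let $\lambda\in[0,1]$. Consider the stabilized Lawson--Euler scheme with time step size $\tau>0$ $$u^{n+1}=u^{n}+\tau\,\mathrm{e}^{\tau\lambda\Delta}\Delta u^{n}$$ for the heat equation $\partial_t u=\lambda\Delta u+(1-\lambda)\Delta u$ on $\Omega$. If $\lambda\ge \frac{1}{2\mathrm{e}}$ (where $\mathrm{e}$ is Euler's number), then this scheme is unconditionally stable.
   Context: Functions of $\Delta$ act on periodic functions as Fourier multipliers, $\Delta$ acting on the $\boldsymbol k$-th Fourier mode ($\boldsymbol k\in\mathbb{Z}^d$) as multiplication by $-k^2$, where $k^2=\sum_{\mu=1}^d k_\mu^2$. The scheme therefore acts on each Fourier coefficient $\hat u^n_{\boldsymbol k}$ of $u^n$ by $\hat u^{n+1}_{\boldsymbol k}=\Phi(z,\lambda)\,\hat u^n_{\boldsymbol k}$ with $z=-\tau k^2$, where the stability function $\Phi(z,\lambda)$ is the scalar amplification factor obtained by formally replacing every occurrence of $\tau\Delta$ in the scheme by the real number $z$. The scheme (with parameter $\lambda$) is called unconditionally stable if $|\Phi(z,\lambda)|\le 1$ for all $z\in(-\infty,0]$. *)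

theory Defs
  imports "HOL-Analysis.Analysis"
begin

text \<open>The dimension is \<open>d = CARD('d)\<close>, which is at least 1 for every index type.\<close>

definition Omega :: "(real ^ 'd::finite) set" where
  "Omega = box (\<chi> i. - pi) (\<chi> i. pi)"

text \<open>
  Periodic functions are taken in the largest class for which all Fourier coefficients
  are defined, namely those that are integrable over one period cell.
\<close>

definition periodic_L1 :: "(real ^ 'd::finite \<Rightarrow> complex) \<Rightarrow> bool" where
  "periodic_L1 u \<longleftrightarrow>
     (\<forall>x i. u (x + axis i (2 * pi)) = u x) \<and> u absolutely_integrable_on Omega"

definition fourier_coeff :: "(real ^ 'd::finite \<Rightarrow> complex) \<Rightarrow> int ^ 'd \<Rightarrow> complex" where
  "fourier_coeff u k =
     (LINT x:Omega|lebesgue. u x * cis (- (\<Sum>\<mu>\<in>UNIV. real_of_int (k $ \<mu>) * x $ \<mu>)))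
       / of_real ((2 * pi) ^ CARD('d))"

definition mode_sq :: "int ^ 'd::finite \<Rightarrow> real" where
  "mode_sq k = (\<Sum>\<mu>\<in>UNIV. (real_of_int (k $ \<mu>))\<^sup>2)"

text \<open>
  \<open>lap_fun f u v\<close> means that \<open>u\<close> is in the domain of the Fourier multiplier \<open>f(\<Delta>)\<close>
  and \<open>v = f(\<Delta>) u\<close>.  It is a relation because \<open>\<Delta>\<close> is unbounded; \<open>v\<close> is determined up to
  a null set.
\<close>

definition lap_fun ::
  "(real \<Rightarrow> real) \<Rightarrow> (real ^ 'd::finite \<Rightarrow> complex) \<Rightarrow> (real ^ 'd \<Rightarrow> complex) \<Rightarrow> bool" where
  "lap_fun f u v \<longleftrightarrow> periodic_L1 u \<and> periodic_L1 v \<and>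
     (\<forall>k. fourier_coeff v k = of_real (f (- mode_sq k)) * fourier_coeff u k)"

text \<open>
  One step \<open>u' = u + \<tau> exp(\<tau> \<lambda> \<Delta>) \<Delta> u\<close>, with \<open>v = \<Delta> u\<close> and \<open>w = exp(\<tau> \<lambda> \<Delta>) v\<close>.
  Since \<open>w\<close> may be changed on a null set, asking for the equation at every point is the same as
  asking for it almost everywhere.
\<close>

definition lawson_euler_step ::
  "real \<Rightarrow> real \<Rightarrow> (real ^ 'd::finite \<Rightarrow> complex) \<Rightarrow> (real ^ 'd \<Rightarrow> complex) \<Rightarrow> bool" where
  "lawson_euler_step lam \<tau> u u' \<longleftrightarrow>
     (\<exists>v w. lap_fun (\<lambda>s. s) u v \<and> lap_fun (\<lambda>s. exp (\<tau> * lam * s)) v w \<and>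
            (\<forall>x. u' x = u x + of_real \<tau> * w x))"

text \<open>
  The stability function: the right-hand side \<open>(1 + exp(\<lambda> \<tau>\<Delta>) \<tau>\<Delta>) u\<close> of the scheme with
  \<open>\<tau>\<Delta>\<close> formally replaced by \<open>z\<close>.
\<close>

definition lawson_euler_Phi :: "real \<Rightarrow> real \<Rightarrow> real" where
  "lawson_euler_Phi z lam = 1 + exp (lam * z) * z"

text \<open>
  A scheme (a one-step relation for each step size \<open>\<tau>\<close>) multiplies the \<open>k\<close>-th Fourier
  coefficient by \<open>\<Phi>(-\<tau> k\<^sup>2)\<close>.  As \<open>\<tau> > 0\<close> and \<open>k\<close> vary, \<open>-\<tau> k\<^sup>2\<close> covers
  the whole half-line of nonpositive reals.
\<close>

definition amplifies_by ::
  "(real \<Rightarrow> (real ^ 'd::finite \<Rightarrow> complex) \<Rightarrow> (real ^ 'd \<Rightarrow> complex) \<Rightarrow> bool) \<Rightarrow> (real \<Rightarrow> real) \<Rightarrow> bool"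
  where
  "amplifies_by step \<Phi> \<longleftrightarrow>
     (\<forall>\<tau>>0. \<forall>u u'. step \<tau> u u' \<longrightarrow>
        (\<forall>k. fourier_coeff u' k = of_real (\<Phi> (- \<tau> * mode_sq k)) * fourier_coeff u k))"

definition unconditionally_stable :: "(real \<Rightarrow> real) \<Rightarrow> bool" where
  "unconditionally_stable \<Phi> \<longleftrightarrow> (\<forall>z\<le>0. \<bar>\<Phi> z\<bar> \<le> 1)"

end

theory Submission imports Defs begin

text \<open>Fourier coefficients are linear on integrable functions
  (\<open>fourier_coeff_add_scaled\<close>), so one step multiplies the \<open>k\<close>-th
  coefficient by 1 + z exp(\<lambda> z) with z = -\<tau> k^2. For z \<le> 0 this factor is at most
  1, since its second term is nonpositive. It is at least -1 iff -z exp(\<lambda> z) \<le> 2. With y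
  = -\<lambda> z, the bound y exp(-y) \<le> 1/e (\<open>mult_exp_minus_le\<close>) gives -z
  exp(\<lambda> z) \<le> 1/(e \<lambda>), which is at most 2 once \<lambda> \<ge> 1/(2e).\<close>

lemma fourier_kernel_continuous:
  "continuous_on S (\<lambda>x :: real ^ 'd::finite. cis (- (\<Sum>\<mu>\<in>UNIV. real_of_int (k $ \<mu>) * x $ \<mu>)))"
  unfolding cis_conv_exp by (intro continuous_intros)

text \<open>The kernel is continuous and of modulus 1, so multiplying by it preserves integrability.
  This is what licenses splitting the integral of a sum below.\<close>

lemma fourier_integrand_integrable:
  fixes u :: "real ^ 'd::finite \<Rightarrow> complex"
  assumes "periodic_L1 u"
  shows "set_integrable lebesgue Omega
           (\<lambda>x. u x * cis (- (\<Sum>\<mu>\<in>UNIV. real_of_int (k $ \<mu>) * x $ \<mu>)))"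
proof -
  let ?e = "\<lambda>x :: real ^ 'd. cis (- (\<Sum>\<mu>\<in>UNIV. real_of_int (k $ \<mu>) * x $ \<mu>))"
  have Omega: "(Omega :: (real ^ 'd) set) \<in> sets lebesgue"
    by (simp add: Omega_def)
  have "(\<lambda>x. ?e x * u x) absolutely_integrable_on Omega"
  proof (rule absolutely_integrable_bounded_measurable_product[OF bilinear_times _ Omega])
    show "?e \<in> borel_measurable (lebesgue_on Omega)"
      by (rule continuous_imp_measurable_on_sets_lebesgue[OF fourier_kernel_continuous Omega])
    show "bounded (?e ` Omega)"
      by (auto simp: bounded_iff intro!: exI[of _ 1])
    show "u absolutely_integrable_on Omega"
      using assms by (simp add: periodic_L1_def)
  qed
  then show ?thesis
    by (simp add: mult.commute)
qed

lemma fourier_coeff_add_scaled: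
  assumes "periodic_L1 u" "periodic_L1 w"
  shows "fourier_coeff (\<lambda>x. u x + c * w x) k = fourier_coeff u k + c * fourier_coeff w k"
  using fourier_integrand_integrable[OF assms(1), of k] fourier_integrand_integrable[OF assms(2), of k]
  by (simp add: fourier_coeff_def distrib_right mult.assoc set_integral_add add_divide_distrib)

lemma lawson_euler_amplifies: "amplifies_by (lawson_euler_step lam) (\<lambda>z. lawson_euler_Phi z lam)"
  unfolding amplifies_by_def
proof (intro allI impI)
  fix \<tau> :: real and u u' :: "real ^ 'd::finite \<Rightarrow> complex" and k
  assume "lawson_euler_step lam \<tau> u u'"
  then obtain v w where v: "lap_fun (\<lambda>s. s) u v"
    and w: "lap_fun (\<lambda>s. exp (\<tau> * lam * s)) v w" and u': "u' = (\<lambda>x. u x + of_real \<tau> * w x)"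
    unfolding lawson_euler_step_def by blast
  have "fourier_coeff u' k = fourier_coeff u k + of_real \<tau> * fourier_coeff w k"
    using v w by (simp add: u' lap_fun_def fourier_coeff_add_scaled)
  \<comment> \<open>The multipliers of \<open>v\<close> and \<open>w\<close> compose: the
    coefficient of \<open>w\<close> is exp(-\<tau> \<lambda> k^2) (-k^2) times that of
    \<open>u\<close>, and the factor \<tau> turns -k^2 into z.\<close>
  then show "fourier_coeff u' k = of_real (lawson_euler_Phi (- \<tau> * mode_sq k) lam) * fourier_coeff u k"
    using v w by (simp add: lap_fun_def lawson_euler_Phi_def algebra_simps)
qed

text \<open>The tangent line of exp at 0, evaluated at y - 1, gives y \<le> exp(y - 1); then divide
  by exp(y). Equality holds at y = 1.\<close>

lemma mult_exp_minus_le: "y * exp (- y) \<le> exp (- 1)" for y :: real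
  using exp_ge_add_one_self[of "y - 1"] by (simp add: exp_diff exp_minus field_simps)

lemma lawson_euler_stable:
  assumes "lam \<ge> 1 / (2 * exp 1)"
  shows "unconditionally_stable (\<lambda>z. lawson_euler_Phi z lam)"
  unfolding unconditionally_stable_def
proof (intro allI impI)
  fix z :: real
  assume "z \<le> 0"
  have "lam > 0"
    using assms by (rule less_le_trans[rotated]) simp
  have "exp (- 1) \<le> 2 * lam"
    using assms by (simp add: exp_minus field_simps)
  \<comment> \<open>Both sides keep a factor \<open>lam\<close>, which is positive and is cancelled
    next.\<close>
  with mult_exp_minus_le[of "- lam * z"] have "lam * (- z * exp (lam * z)) \<le> lam * 2"
    by (simp add: mult_ac)
  then have "- z * exp (lam * z) \<le> 2"
    using \<open>lam > 0\<close> by (simp only: mult_le_cancel_left_pos)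
  moreover have "exp (lam * z) * z \<le> 0"
    using \<open>z \<le> 0\<close> by (simp add: mult_nonneg_nonpos)
  ultimately show "\<bar>lawson_euler_Phi z lam\<bar> \<le> 1"
    by (simp add: lawson_euler_Phi_def abs_le_iff mult.commute)
qed

theorem theorem2p3:
  fixes lam :: real
  assumes "0 \<le> lam" and "lam \<le> 1"
    and "lam \<ge> 1 / (2 * exp 1)"
  shows "amplifies_by
           (lawson_euler_step lam ::
              real \<Rightarrow> (real ^ 'd::finite \<Rightarrow> complex) \<Rightarrow> (real ^ 'd \<Rightarrow> complex) \<Rightarrow> bool)
           (\<lambda>z. lawson_euler_Phi z lam)
         \<and> unconditionally_stable (\<lambda>z. lawson_euler_Phi z lam)"
  using lawson_euler_amplifies lawson_euler_stable[OF assms(3)] by blast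

end
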